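(* Let $f:\mathbb R^{d}\to\mathbb R\cup\{\infty\}$ be a proper function with DCL $(f_{\mathrm{cvx}},f_{\mathrm{lft}},\Phi)$. Then, for any $\boldsymbol x\in\mathrm{dom}(f)$ at which $f$ is differentiable, $f$ satisfies the weak-PL condition $$\|\nabla f(\boldsymbol x)\|\ \ge\ \alpha_{\mathrm{DCL}}(\boldsymbol x)\cdot\big(f(\boldsymbol x)-\inf(f)\big),\qquad \alpha_{\mathrm{DCL}}(\boldsymbol x):=\max_{\substack{\boldsymbol z^\star\in\arg\min f_{\mathrm{cvx}}(\cdot)\\ \boldsymbol\xi\in\arg\min f_{\mathrm{lft}}(\boldsymbol x,\cdot)}}\ \frac{\sigma_{d_z}\big(\nabla\Phi(\boldsymbol x,\boldsymbol\xi)\big)}{\|\Phi(\boldsymbol x,\boldsymbol\xi)-\boldsymbol z^\star\|}.$$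
   Context: Functions take values in $\mathbb R\cup\{\infty\}$; $\mathrm{dom}(f)=\{\boldsymbol x:f(\boldsymbol x)\neq\infty\}$; $f$ is proper if $\mathrm{dom}(f)\ne\emptyset$; $\inf(f)=\inf_{\boldsymbol x}f(\boldsymbol x)$. $\|\cdot\|$ is the Euclidean norm and $\sigma_{j}(M)$ is the $j$-th largest singular value of $M$ (zero if $j$ exceeds a dimension of $M$); $\nabla\Phi$ is the Jacobian of $\Phi$. A triplet $(f_{\mathrm{cvx}},f_{\mathrm{lft}},\Phi)$ is a DCL (differentiable convex lifting) of a proper $f:\mathbb R^d\to\mathbb R\cup\{\infty\}$ if: 1. $f_{\mathrm{cvx}}:\mathbb R^{d_z}\to\mathbb R\cup\{\infty\}$ is a proper convex function whose minimum is attained by some $\boldsymbol z^\star$, $f_{\mathrm{cvx}}(\boldsymbol z^\star)=\inf(f_{\mathrm{cvx}})>-\infty$. 2. For some $d_\xi\ge0$, $f_{\mathrm{lft}}:\mathbb R^{d+d_\xi}\to\mathbb R\cup\{\infty\}$ satisfies $f(\boldsymbol x)=\min_{\boldsymbol\xi\in\mathbb R^{d_\xi}}f_{\mathrm{lft}}(\boldsymbol x,\boldsymbol\xi)$ (with the minimum attained). 3. There is an open set $\mathcal Y\subseteq\mathbb R^{d+d_\xi}$ containing $\mathrm{dom}(f_{\mathrm{lft}})$ and a continuously differentiable map $\Phi:\mathcal Y\to\mathbb R^{d_z}$ with $f_{\mathrm{lft}}(\cdot)=f_{\mathrm{cvx}}(\Phi(\cdot))$ on $\mathcal Y$. Neither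 $f_{\mathrm{cvx}}$ nor $f_{\mathrm{lft}}$ is assumed differentiable. If $f(\boldsymbol x)=\inf(f)$, the right-hand side of the inequality is read as $0$ (even if a denominator vanishes).
   Formalization: The maximum defining α_DCL is read as a supremum: it need not be attained under the stated hypotheses (the set of minimizers of f_cvx need not be closed), and the two agree whenever the maximum exists. *)

theory Defs
  imports "HOL-Analysis.Analysis"
begin

subsection \<open>Extended-real-valued functions\<close>

text \<open>
  Functions into the reals extended by \<open>\<infinity>\<close> are represented as functions into
  \<^typ>\<open>ereal\<close> that never take the value \<open>-\<infinity>\<close>.
\<close>

definition no_minus_infinity :: "('a \<Rightarrow> ereal) \<Rightarrow> bool" where
  "no_minus_infinity f \<longleftrightarrow> (\<forall>x. f x \<noteq> - \<infinity>)"

definition edom :: "('a \<Rightarrow> ereal) \<Rightarrow> 'a set" where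
  "edom f = {x. f x \<noteq> \<infinity>}"

definition proper_fun :: "('a \<Rightarrow> ereal) \<Rightarrow> bool" where
  "proper_fun f \<longleftrightarrow> no_minus_infinity f \<and> edom f \<noteq> {}"

definition econvex :: "('a::real_vector \<Rightarrow> ereal) \<Rightarrow> bool" where
  "econvex f \<longleftrightarrow> (\<forall>x y. \<forall>u\<ge>0. \<forall>v\<ge>0. u + v = 1 \<longrightarrow>
     f (u *\<^sub>R x + v *\<^sub>R y) \<le> ereal u * f x + ereal v * f y)"

definition argmin_on :: "'a set \<Rightarrow> ('a \<Rightarrow> ereal) \<Rightarrow> 'a set" where
  "argmin_on S f = {x. is_arg_min f (\<lambda>x. x \<in> S) x}"

text \<open>
  Differentiability at \<open>x\<close> with gradient \<open>g\<close>. The first conjunct is needed because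
  \<^const>\<open>real_of_ereal\<close> sends \<open>\<infinity>\<close> to \<open>0\<close>.
\<close>

definition has_egradient ::
  "('a::real_inner \<Rightarrow> ereal) \<Rightarrow> 'a \<Rightarrow> 'a \<Rightarrow> bool" where
  "has_egradient f x g \<longleftrightarrow>
     (\<forall>\<^sub>F y in nhds x. \<bar>f y\<bar> \<noteq> \<infinity>) \<and> GDERIV (\<lambda>y. real_of_ereal (f y)) x :> g"


subsection \<open>Singular values\<close>

definition sing_space :: "real^'n^'m \<Rightarrow> real \<Rightarrow> (real^'n) set" where
  "sing_space M s = {v. (transpose M ** M) *v v = s\<^sup>2 *\<^sub>R v}"

definition sing_vals :: "real^'n^'m \<Rightarrow> real set" where
  "sing_vals M = {s. 0 \<le> s \<and> sing_space M s \<noteq> {0}}"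

text \<open>
  The singular values in decreasing order, repeated according to multiplicity. The list
  comes from the \<open>n\<close> eigenvalues of \<open>M\<^sup>T M\<close>, so for a wide \<open>m \<times> n\<close> matrix
  it carries extra trailing zeros; these agree with the convention below that the
  \<open>j\<close>-th singular value is \<open>0\<close> when \<open>j\<close> exceeds a dimension of \<open>M\<close>.
\<close>

definition sing_val_list :: "real^'n^'m \<Rightarrow> real list" where
  "sing_val_list M = rev (sorted_list_of_multiset
     (\<Sum>s\<in>sing_vals M. replicate_mset (dim (sing_space M s)) s))"

definition singular_value :: "nat \<Rightarrow> real^'n^'m \<Rightarrow> real" where
  "singular_value j M =
     (if 1 \<le> j \<and> j \<le> length (sing_val_list M) then sing_val_list M ! (j - 1) else 0)"


subsection \<open>Splitting coordinates\<close>

text \<open>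
  As \<open>d\<^sub>\<xi> = 0\<close> is allowed and index types are nonempty, the space of dimension
  \<open>d\<^sub>\<xi> = k\<close> is \<open>rvec k\<close>, the functions on \<open>{..<k}\<close>. The space of dimension
  \<open>d + d\<^sub>\<xi>\<close> is \<open>real^'n\<close>, where \<open>p\<close> identifies the index type \<open>'n\<close> with the disjoint
  sum of \<open>'d\<close> and \<open>{..<k}\<close>; then \<open>join p x \<xi>\<close> is the concatenation \<open>(x, \<xi>)\<close>.
\<close>

definition rvec :: "nat \<Rightarrow> (nat \<Rightarrow> real) set" where
  "rvec k = ({..<k} \<rightarrow>\<^sub>E UNIV)"

definition index_split :: "nat \<Rightarrow> ('n::finite \<Rightarrow> 'd::finite + nat) \<Rightarrow> bool" where
  "index_split k p \<longleftrightarrow> bij_betw p UNIV (UNIV <+> {..<k})"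

definition join :: "('n::finite \<Rightarrow> 'd::finite + nat) \<Rightarrow> real^'d \<Rightarrow> (nat \<Rightarrow> real) \<Rightarrow> real^'n" where
  "join p x \<xi> = (\<chi> i. case p i of Inl a \<Rightarrow> x $ a | Inr b \<Rightarrow> \<xi> b)"


subsection \<open>Differentiable convex liftings\<close>

definition C1_on :: "(real^'n) set \<Rightarrow> (real^'n \<Rightarrow> real^'m) \<Rightarrow> bool" where
  "C1_on Y F \<longleftrightarrow> (\<forall>w\<in>Y. F differentiable (at w)) \<and> continuous_on Y (\<lambda>w. jacobian F (at w))"

text \<open>
  The lifting map \<open>\<Phi>\<close> is only meant on the open set \<open>Y\<close>; its values elsewhere are irrelevant.
\<close>

definition is_DCL ::
  "nat \<Rightarrow> ('n::finite \<Rightarrow> 'd::finite + nat) \<Rightarrow> (real^'d \<Rightarrow> ereal) \<Rightarrow>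
   (real^'z \<Rightarrow> ereal) \<Rightarrow> (real^'n \<Rightarrow> ereal) \<Rightarrow> (real^'n \<Rightarrow> real^'z) \<Rightarrow> bool" where
  "is_DCL k p f fcvx flft \<Phi> \<longleftrightarrow>
     proper_fun fcvx \<and> econvex fcvx \<and> argmin_on UNIV fcvx \<noteq> {} \<and>
     no_minus_infinity flft \<and>
     (\<forall>x. \<exists>\<xi>\<in>argmin_on (rvec k) (\<lambda>\<xi>. flft (join p x \<xi>)). f x = flft (join p x \<xi>)) \<and>
     (\<exists>Y. open Y \<and> edom flft \<subseteq> Y \<and> C1_on Y \<Phi> \<and> (\<forall>w\<in>Y. flft w = fcvx (\<Phi> w)))"

text \<open>
  The coefficient is a supremum in \<^typ>\<open>ereal\<close>, which equals the maximum whenever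
  the maximum is attained.
\<close>

definition alpha_DCL ::
  "nat \<Rightarrow> ('n::finite \<Rightarrow> 'd::finite + nat) \<Rightarrow> (real^'z \<Rightarrow> ereal) \<Rightarrow>
   (real^'n \<Rightarrow> ereal) \<Rightarrow> (real^'n \<Rightarrow> real^'z) \<Rightarrow> real^'d \<Rightarrow> ereal" where
  "alpha_DCL k p fcvx flft \<Phi> x =
     (SUP (z, \<xi>) \<in> argmin_on UNIV fcvx \<times> argmin_on (rvec k) (\<lambda>\<xi>. flft (join p x \<xi>)).
        ereal (singular_value CARD('z) (jacobian \<Phi> (at (join p x \<xi>)))) /
        ereal (norm (\<Phi> (join p x \<xi>) - z)))"

end

theory Submission
  imports Defs
begin

text \<open>
  Let \<open>w = (x, \<xi>)\<close> with \<open>\<xi>\<close> optimal, and let \<open>\<sigma> > 0\<close> be the relevant singular value of the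
  Jacobian \<open>J\<close> of \<open>\<Phi>\<close> at \<open>w\<close>. By convexity, moving \<open>\<Phi>\<close> from \<open>\<Phi> w\<close> straight towards a minimiser
  \<open>z\<close> decreases \<open>fcvx\<close> at rate at least \<open>f x - fcvx z\<close>. On the span of the eigenspaces of
  \<open>J\<^sup>T J\<close> with eigenvalues at least \<open>\<sigma>\<^sup>2\<close>, the map \<open>J\<close> is onto and stretches by at least \<open>\<sigma>\<close>, so
  it has a right inverse of norm at most \<open>1 / \<sigma>\<close>; by the inverse function theorem the segment
  therefore lifts to a curve starting at \<open>w\<close> with speed at most \<open>norm (z - \<Phi> w) / \<sigma>\<close>. Since \<open>f\<close> lies
  below \<open>flft\<close> along this curve, with equality at \<open>w\<close>, the derivative of \<open>f\<close> along the projected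
  curve is at most \<open>fcvx z - f x\<close>, and Cauchy-Schwarz bounds the gradient from below.
\<close>

section \<open>Singular values\<close>

text \<open>A positive value is not the default \<open>0\<close>, so \<open>j\<close> is a genuine
  position in the decreasing list. Its first \<open>j\<close> entries are at least the
  \<open>j\<close>-th one, and multiplicities in the list are dimensions of eigenspaces.\<close>

lemma singular_value_pos_imp_dim_sum:
  fixes M :: "real^'n^'m"
  assumes "0 < singular_value j M"
  shows "finite (sing_vals M) \<and>
    j \<le> (\<Sum>s | s \<in> sing_vals M \<and> singular_value j M \<le> s. dim (sing_space M s))"
proof -
  define N where "N = (\<Sum>s\<in>sing_vals M. replicate_mset (dim (sing_space M s)) s)"
  define L where "L = rev (sorted_list_of_multiset N)"
  define \<sigma> where "\<sigma> = singular_value j M"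
  have j: "1 \<le> j" "j \<le> length L" and \<sigma>: "\<sigma> = L ! (j - 1)"
    using assms unfolding singular_value_def sing_val_list_def L_def N_def \<sigma>_def
    by (auto split: if_splits)
  have fin: "finite (sing_vals M)"
  proof (rule ccontr)
    assume "infinite (sing_vals M)"
    \<comment> \<open>A sum over an infinite set is zero by convention, here the empty
      multiset.\<close>
    then have "L = []" by (simp add: L_def N_def)
    with j show False by simp
  qed
  have mset: "mset L = N" by (simp add: L_def)
  have sorted: "sorted_wrt (\<ge>) L"
    by (simp add: L_def sorted_wrt_rev)
  have "\<sigma> \<le> y" if "y \<in> set (take j L)" for y
  proof -
    from that obtain i where i: "i < j" "y = L ! i"
      using j by (auto simp: in_set_conv_nth)
    show ?thesis
    proof (cases "i = j - 1")
      case False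
      then have "i < j - 1" using i by simp
      then have "L ! (j - 1) \<le> L ! i"
        using sorted j by (auto simp: sorted_wrt_iff_nth_less)
      then show ?thesis using i \<sigma> by simp
    qed (use i \<sigma> in simp)
  qed
  then have "filter (\<lambda>s. \<sigma> \<le> s) (take j L) = take j L"
    by (simp add: filter_id_conv)
  then have "j \<le> length (filter (\<lambda>s. \<sigma> \<le> s) (take j L @ drop j L))"
    using j by (simp only: filter_append) simp
  also have "\<dots> = size (filter_mset (\<lambda>s. \<sigma> \<le> s) N)"
    by (metis append_take_drop_id mset mset_filter size_mset)
  also have "filter_mset (\<lambda>s. \<sigma> \<le> s) N =
      (\<Sum>s\<in>sing_vals M. if \<sigma> \<le> s then replicate_mset (dim (sing_space M s)) s else {#})"
  proof -
    have "filter_mset (\<lambda>s. \<sigma> \<le> s) (replicate_mset n s) =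
        (if \<sigma> \<le> s then replicate_mset n s else {#})" for n s
      by (induction n) auto
    with fin show ?thesis
      unfolding N_def by (induction rule: finite_induct) simp_all
  qed
  also have "size \<dots> = (\<Sum>s\<in>sing_vals M. if \<sigma> \<le> s then dim (sing_space M s) else 0)"
    unfolding size_multiset_sum by (rule sum.cong) auto
  also have "\<dots> = (\<Sum>s | s \<in> sing_vals M \<and> \<sigma> \<le> s. dim (sing_space M s))"
    using fin by (simp add: sum.inter_filter)
  finally show ?thesis using fin by (simp add: \<sigma>_def)
qed

lemma subspace_sing_space: "subspace (sing_space M s)"
  by (auto simp: subspace_def sing_space_def matrix_vector_right_distrib scaleR_right_distrib
      matrix_vector_mult_scaleR)

text \<open>Moving \<open>M\<close> across the inner product turns the left side into
  \<open>u\<close> against \<open>M\<^sup>T M v\<close>, and \<open>v\<close> is an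
  eigenvector.\<close>

lemma inner_sing_space:
  fixes M :: "real^'n^'m"
  assumes "v \<in> sing_space M s"
  shows "(M *v u) \<bullet> (M *v v) = s\<^sup>2 * (u \<bullet> v)"
proof -
  have "(M *v u) \<bullet> (M *v v) = u \<bullet> (transpose M *v (M *v v))"
    using dot_lmul_matrix[of "M *v v" M u] by (simp add: inner_commute)
  also have "\<dots> = s\<^sup>2 * (u \<bullet> v)"
    using assms by (simp add: sing_space_def matrix_vector_mul_assoc)
  finally show ?thesis .
qed

text \<open>The inner product of the images \<open>M u\<close> and \<open>M v\<close> can be
  evaluated through either eigenvector, with factor \<open>s\<^sup>2\<close> or
  \<open>t\<^sup>2\<close>; these differ because \<open>s\<close> and \<open>t\<close> are
  nonnegative.\<close>

lemma orthogonal_sing_space: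
  fixes M :: "real^'n^'m"
  assumes "u \<in> sing_space M s" "v \<in> sing_space M t" "0 \<le> s" "0 \<le> t" "s \<noteq> t"
  shows "orthogonal u v"
proof -
  have "s\<^sup>2 * (u \<bullet> v) = t\<^sup>2 * (u \<bullet> v)"
    using inner_sing_space[OF assms(1), of v] inner_sing_space[OF assms(2), of u]
    by (simp only: inner_commute)
  moreover have "s\<^sup>2 \<noteq> t\<^sup>2" using assms by simp
  ultimately show ?thesis by (auto simp: orthogonal_def)
qed

text \<open>Orthogonal eigenvectors have orthogonal images, so Pythagoras expands both
  \<open>v\<close> and \<open>M v\<close>, and the squares compare term by term.\<close>

lemma norm_matrix_span_orthonormal_ge:
  fixes M :: "real^'n^'m"
  assumes B: "finite B" "pairwise orthogonal B" "\<And>b. b \<in> B \<Longrightarrow> norm b = 1"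
    and ev: "\<And>b. b \<in> B \<Longrightarrow> \<exists>s\<ge>\<sigma>. b \<in> sing_space M s"
    and "0 \<le> \<sigma>" and v: "v \<in> span B"
  shows "\<sigma> * norm v \<le> norm (M *v v)"
proof -
  obtain a where a: "v = (\<Sum>b\<in>B. a b *\<^sub>R b)"
    using v span_finite[OF B(1)] by auto
  have "(\<sigma> * norm v)\<^sup>2 = (\<Sum>b\<in>B. \<sigma>\<^sup>2 * (norm (a b *\<^sub>R b))\<^sup>2)"
    unfolding a power_mult_distrib
    by (subst norm_sum_Pythagorean[OF B(1)])
      (use B(2) in \<open>auto simp: pairwise_def orthogonal_def sum_distrib_left\<close>)
  also have "\<dots> \<le> (\<Sum>b\<in>B. (norm (a b *\<^sub>R (M *v b)))\<^sup>2)"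
  proof (rule sum_mono)
    fix b assume b: "b \<in> B"
    then obtain s where s: "\<sigma> \<le> s" "b \<in> sing_space M s" using ev by blast
    have "(norm (M *v b))\<^sup>2 = s\<^sup>2"
      using inner_sing_space[OF s(2), of b] B(3)[OF b]
      by (simp add: dot_square_norm)
    moreover have "\<sigma>\<^sup>2 \<le> s\<^sup>2" using s \<open>0 \<le> \<sigma>\<close> by (simp add: power_mono)
    ultimately have "\<sigma>\<^sup>2 * (a b)\<^sup>2 \<le> (norm (M *v b))\<^sup>2 * (a b)\<^sup>2"
      by (simp add: mult_right_mono)
    then show "\<sigma>\<^sup>2 * (norm (a b *\<^sub>R b))\<^sup>2 \<le> (norm (a b *\<^sub>R (M *v b)))\<^sup>2"
      using B(3)[OF b] by (simp add: power_mult_distrib mult.commute)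
  qed
  also have "\<dots> = (norm (\<Sum>b\<in>B. a b *\<^sub>R (M *v b)))\<^sup>2"
  proof (rule norm_sum_Pythagorean[OF B(1), symmetric])
    show "pairwise (\<lambda>i j. orthogonal (a i *\<^sub>R (M *v i)) (a j *\<^sub>R (M *v j))) B"
      unfolding pairwise_def orthogonal_def
    proof (intro ballI impI)
      fix i j assume ij: "i \<in> B" "j \<in> B" "i \<noteq> j"
      obtain s where "j \<in> sing_space M s" using ev ij by blast
      moreover have "i \<bullet> j = 0" using B(2) ij by (auto simp: pairwise_def orthogonal_def)
      ultimately show "a i *\<^sub>R (M *v i) \<bullet> a j *\<^sub>R (M *v j) = 0"
        by (simp add: inner_sing_space)
    qed
  qed
  also have "(\<Sum>b\<in>B. a b *\<^sub>R (M *v b)) = M *v v"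
    unfolding a by (simp add: matrix_vector_mult_scaleR linear_sum[OF matrix_vector_mul_linear])
  finally show ?thesis
    by (rule power2_le_imp_le) simp
qed

text \<open>Eigenvectors for singular values at least \<open>\<sigma>\<close> supply an orthonormal
  set \<open>B\<close> of at least \<open>CARD('m)\<close> vectors. On its span \<open>M\<close>
  stretches by at least \<open>\<sigma>\<close>, hence is injective, and counting dimensions makes
  it onto. \<open>A\<close> inverts this restriction.\<close>

lemma singular_value_right_inverse:
  fixes M :: "real^'n^'m"
  assumes pos: "0 < singular_value CARD('m) M"
  obtains A :: "real^'m \<Rightarrow> real^'n" where "linear A" "\<And>d. M *v A d = d"
    "\<And>d. singular_value CARD('m) M * norm (A d) \<le> norm d"
proof -
  define \<sigma> where "\<sigma> = singular_value CARD('m) M"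
  define S where "S = {s \<in> sing_vals M. \<sigma> \<le> s}"
  have "0 < \<sigma>" using pos by (simp add: \<sigma>_def)
  have fin: "finite S" and le: "CARD('m) \<le> (\<Sum>s\<in>S. dim (sing_space M s))"
    using singular_value_pos_imp_dim_sum[OF pos] by (auto simp: S_def \<sigma>_def)
  have "\<exists>B. B \<subseteq> sing_space M s \<and> pairwise orthogonal B \<and> (\<forall>b\<in>B. norm b = 1) \<and>
      finite B \<and> card B = dim (sing_space M s)" for s
    using orthonormal_basis_subspace[OF subspace_sing_space, of M s]
    by (metis independent_imp_finite)
  then obtain C where C: "\<And>s. C s \<subseteq> sing_space M s" "\<And>s. pairwise orthogonal (C s)"
      "\<And>s b. b \<in> C s \<Longrightarrow> norm b = 1" "\<And>s. finite (C s)"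
      "\<And>s. card (C s) = dim (sing_space M s)"
    by metis
  define B where "B = (\<Union>s\<in>S. C s)"
  have orth: "orthogonal u v" if "u \<in> C s" "v \<in> C t" "s \<in> S" "t \<in> S" "s \<noteq> t" for u v s t
    using that C(1) orthogonal_sing_space[of u M s v t] by (auto simp: S_def sing_vals_def)
  have finB: "finite B" using fin C(4) by (simp add: B_def)
  \<comment> \<open>A common vector would be orthogonal to itself despite having norm 1.
    Disjointness lets the cardinalities add up.\<close>
  have "C s \<inter> C t = {}" if "s \<in> S" "t \<in> S" "s \<noteq> t" for s t
    using orth[OF _ _ that] C(3) by (fastforce simp: orthogonal_def)
  then have cardB: "CARD('m) \<le> card B"
    unfolding B_def using fin C(4,5) le by (subst card_UN_disjoint) auto
  have orthB: "pairwise orthogonal B"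
    unfolding B_def pairwise_def using orth C(2) by (fastforce simp: pairwise_def)
  have normB: "norm b = 1" if "b \<in> B" for b
    using that C(3) by (auto simp: B_def)
  have evB: "\<exists>s\<ge>\<sigma>. b \<in> sing_space M s" if "b \<in> B" for b
    using that C(1) by (auto simp: B_def S_def)
  have bound: "\<sigma> * norm v \<le> norm (M *v v)" if "v \<in> span B" for v
    using norm_matrix_span_orthonormal_ge[OF finB orthB normB evB _ that] \<open>0 < \<sigma>\<close> by simp
  have inj: "inj_on ((*v) M) (span B)"
  proof (rule inj_onI)
    fix u v assume uv: "u \<in> span B" "v \<in> span B" "M *v u = M *v v"
    then have "\<sigma> * norm (u - v) \<le> 0"
      using bound[of "u - v"] by (simp add: span_diff matrix_vector_mult_diff_distrib)
    then show "u = v" using \<open>0 < \<sigma>\<close> by (simp add: mult_le_0_iff)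
  qed
  have "independent B"
    by (rule pairwise_orthogonal_independent[OF orthB]) (use normB in force)
  then have "dim (span B) = card B"
    by (simp add: dim_eq_card_independent)
  then have "dim ((*v) M ` span B) = card B"
    using dim_image_eq[OF matrix_vector_mul_linear[of M], of "span B"] inj
    by (metis span_span)
  moreover have "dim ((*v) M ` span B) \<le> CARD('m)"
    by (rule dim_subset_UNIV_cart)
  ultimately have "span ((*v) M ` span B) = UNIV"
    using cardB dim_eq_full[of "(*v) M ` span B"] by simp
  then have surj: "(*v) M ` span B = UNIV"
    by (metis linear_span_image[OF matrix_vector_mul_linear[of M]] span_span)
  obtain A where A: "range A \<subseteq> span B" "linear A" "\<And>v. v \<in> span B \<Longrightarrow> A (M *v v) = v"
    using linear_exists_left_inverse_on[OF matrix_vector_mul_linear subspace_span inj] by blast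
  have right: "M *v A d = d" for d
  proof -
    obtain v where "v \<in> span B" "d = M *v v" using surj by blast
    then show ?thesis using A(3) by simp
  qed
  have "\<sigma> * norm (A d) \<le> norm d" for d
    using bound[of "A d"] A(1) right by auto
  then show ?thesis using that A(2) right by (simp add: \<sigma>_def)
qed

section \<open>Lifting segments through a submersion\<close>

text \<open>Precomposing \<open>F\<close> with \<open>y \<mapsto> w + A y\<close> gives a map
  \<open>h\<close> between spaces of equal dimension whose derivative at 0 is the identity. Its
  local inverse \<open>G\<close> yields the curve \<open>w + A (G (F w + t d))\<close>.\<close>

lemma C1_on_lift_segment:
  fixes F :: "real^'n \<Rightarrow> real^'m"
  assumes "open Y" "C1_on Y F" "w \<in> Y" "linear A"
    and right: "\<And>d. jacobian F (at w) *v A d = d"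
  obtains c where "c 0 = w" "(c has_vector_derivative A d) (at 0)"
    "\<forall>\<^sub>F t in nhds 0. c t \<in> Y \<and> F (c t) = F w + t *\<^sub>R d"
proof -
  have blA: "bounded_linear A" using \<open>linear A\<close> by (simp add: linear_conv_bounded_linear)
  have A0: "A 0 = 0" using \<open>linear A\<close> by (rule linear_0)
  define h where "h y = F (w + A y)" for y
  define U where "U = {y. w + A y \<in> Y}"
  \<comment> \<open>The inverse function theorem expects the derivative as a continuous map into the
    bounded linear operators.\<close>
  define h' where "h' y = Blinfun (\<lambda>u. jacobian F (at (w + A y)) *v A u)" for y
  have h'_apply: "blinfun_apply (h' y) = (\<lambda>u. jacobian F (at (w + A y)) *v A u)" for y
    unfolding h'_def
    by (intro bounded_linear_Blinfun_apply bounded_linear_compose[OF _ blA]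
        matrix_vector_mul_bounded_linear)
  have contA: "continuous_on UNIV (\<lambda>y. w + A y)"
    by (intro continuous_intros linear_continuous_on blA)
  have "open U"
    using open_vimage[OF \<open>open Y\<close> contA] by (simp add: U_def vimage_def)
  have derh: "(h has_derivative blinfun_apply (h' y)) (at y)" if "y \<in> U" for y
  proof -
    have "F differentiable (at (w + A y))"
      using that \<open>C1_on Y F\<close> by (simp add: U_def C1_on_def)
    then have F': "(F has_derivative (\<lambda>u. jacobian F (at (w + A y)) *v u)) (at (w + A y))"
      by (simp add: jacobian_works)
    have "((\<lambda>y. w + A y) has_derivative A) (at y)"
      by (auto intro!: derivative_eq_intros bounded_linear_imp_has_derivative blA)
    from has_derivative_compose[OF this F'] show ?thesis
      by (simp add: h_def[abs_def] h'_apply)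
  qed
  have conth: "continuous_on U h'"
  proof (rule continuous_on_blinfun_componentwise)
    fix i :: "real^'m"
    have "continuous_on U (\<lambda>y. jacobian F (at (w + A y)))"
      using \<open>C1_on Y F\<close> continuous_on_subset[OF contA]
      by (intro continuous_on_compose2[of Y "\<lambda>w. jacobian F (at w)" U "\<lambda>y. w + A y"])
        (auto simp: C1_on_def U_def)
    then show "continuous_on U (\<lambda>y. h' y i)"
      unfolding h'_apply matrix_vector_mult_def
      by (intro continuous_intros)
  qed
  have zero: "0 \<in> U" using \<open>w \<in> Y\<close> by (simp add: U_def A0)
  have h'0: "h' 0 = id_blinfun"
    by (rule blinfun_eqI) (simp add: h'_apply A0 right)
  then have compose: "id_blinfun o\<^sub>L h' 0 = id_blinfun" by (simp add: blinfun_eqI)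
  obtain U' V G G' where "open U'" and *: "U' \<subseteq> U" "0 \<in> U'" "open V" "h 0 \<in> V"
      "homeomorphism U' V h G"
      "\<And>y. y \<in> V \<Longrightarrow> (G has_derivative (G' y)) (at y)"
      "\<And>y. y \<in> V \<Longrightarrow> G' y = inv (blinfun_apply (h' (G y)))"
      "\<And>y. y \<in> V \<Longrightarrow> bij (blinfun_apply (h' (G y)))"
    using inverse_function_theorem[OF \<open>open U\<close> derh conth zero compose] by blast
  have h0: "h 0 = F w" by (simp add: h_def A0)
  have G0: "G (F w) = 0"
    using *(2,5) h0 by (auto simp: homeomorphism_def)
  have id_h'0: "blinfun_apply (h' 0) = id" by (simp add: h'0 fun_eq_iff)
  \<comment> \<open>The derivative of \<open>G\<close> at \<open>F w\<close> inverts that of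
    \<open>h\<close> at \<open>G (F w) = 0\<close>, which is the identity; this gives the curve its
    initial velocity \<open>A d\<close>.\<close>
  have "G' (F w) = id"
    using *(7)[OF *(4)] h0 G0 id_h'0 by simp
  then have G': "(G has_derivative id) (at (F w + 0 *\<^sub>R d))"
    using *(6)[OF *(4)] h0 by simp
  have "((\<lambda>t. F w + t *\<^sub>R d) has_derivative (\<lambda>t. t *\<^sub>R d)) (at 0)"
    by (auto intro!: derivative_eq_intros)
  from has_derivative_compose[OF this G']
  have "((\<lambda>t. G (F w + t *\<^sub>R d)) has_derivative (\<lambda>t. t *\<^sub>R d)) (at 0)"
    by simp
  from bounded_linear.has_derivative[OF blA this]
  have "((\<lambda>t. w + A (G (F w + t *\<^sub>R d))) has_derivative (\<lambda>t. t *\<^sub>R A d)) (at 0)"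
    by (auto intro!: derivative_eq_intros simp: linear_cmul[OF \<open>linear A\<close>])
  then have der: "((\<lambda>t. w + A (G (F w + t *\<^sub>R d))) has_vector_derivative A d) (at 0)"
    by (simp add: has_vector_derivative_def)
  have "((\<lambda>t. F w + t *\<^sub>R d) \<longlongrightarrow> F w + 0 *\<^sub>R d) (nhds 0)"
    by (intro tendsto_intros filterlim_ident)
  then have "\<forall>\<^sub>F t in nhds 0. F w + t *\<^sub>R d \<in> V"
    using *(3,4) h0 by (auto dest: topological_tendstoD)
  then have "\<forall>\<^sub>F t in nhds 0. w + A (G (F w + t *\<^sub>R d)) \<in> Y \<and>
      F (w + A (G (F w + t *\<^sub>R d))) = F w + t *\<^sub>R d"
  proof (rule eventually_mono)
    fix t assume t: "F w + t *\<^sub>R d \<in> V"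
    then have "G (F w + t *\<^sub>R d) \<in> U" "h (G (F w + t *\<^sub>R d)) = F w + t *\<^sub>R d"
      using *(1,5) by (auto simp: homeomorphism_def)
    then show "w + A (G (F w + t *\<^sub>R d)) \<in> Y \<and>
        F (w + A (G (F w + t *\<^sub>R d))) = F w + t *\<^sub>R d"
      by (simp add: U_def h_def)
  qed
  with der show ?thesis
    using that[of "\<lambda>t. w + A (G (F w + t *\<^sub>R d))"] by (simp add: G0 A0)
qed

section \<open>Splitting coordinates\<close>

definition proj_left :: "('n::finite \<Rightarrow> 'd::finite + nat) \<Rightarrow> real^'n \<Rightarrow> real^'d" where
  "proj_left p w = (\<chi> a. w $ inv p (Inl a))"

lemma linear_proj_left: "linear (proj_left p)"
  by (rule linearI) (auto simp: proj_left_def vec_eq_iff)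

text \<open>\<open>p\<close> is onto \<open>UNIV <+> {..<k}\<close> only, not onto its whole
  codomain type, so the second law is restricted to \<open>b < k\<close>.\<close>

lemma index_split_inv:
  assumes "index_split k p"
  shows "p (inv p (Inl a)) = Inl a" and "b < k \<Longrightarrow> p (inv p (Inr b)) = Inr b"
  using assms unfolding index_split_def bij_betw_def
  by (auto intro!: f_inv_into_f)

lemma proj_left_join:
  assumes "index_split k p"
  shows "proj_left p (join p x \<xi>) = x"
  by (simp add: proj_left_def join_def index_split_inv[OF assms] vec_eq_iff)

text \<open>The projection keeps distinct coordinates of \<open>w\<close>, so its sum of squares is
  part of that of \<open>w\<close>.\<close>

lemma norm_proj_left_le:
  assumes "index_split k p"
  shows "norm (proj_left p w) \<le> norm w"
proof -
  have inj: "inj (\<lambda>a. inv p (Inl a))"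
    by (rule injI) (metis index_split_inv(1)[OF assms] sum.inject(1))
  have "(\<Sum>a\<in>UNIV. (w $ inv p (Inl a))\<^sup>2) = (\<Sum>i\<in>range (\<lambda>a. inv p (Inl a)). (w $ i)\<^sup>2)"
    by (simp add: sum.reindex[OF inj])
  also have "\<dots> \<le> (\<Sum>i\<in>UNIV. (w $ i)\<^sup>2)"
    by (rule sum_mono2) auto
  finally show ?thesis
    by (simp add: norm_vec_def L2_set_def proj_left_def)
qed

lemma join_proj_left:
  assumes "index_split k p"
  obtains \<xi> where "\<xi> \<in> rvec k" "join p (proj_left p w) \<xi> = w"
proof
  \<comment> \<open>Members of \<open>rvec k\<close> are extensional, which forces
    \<open>undefined\<close> outside \<open>{..<k}\<close>.\<close>
  let ?\<xi> = "\<lambda>b. if b < k then w $ inv p (Inr b) else undefined"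
  show "?\<xi> \<in> rvec k" by (auto simp: rvec_def split: if_splits)
  have bij: "bij_betw p UNIV (UNIV <+> {..<k})" using assms by (simp add: index_split_def)
  have "(case p i of Inl a \<Rightarrow> proj_left p w $ a | Inr b \<Rightarrow> ?\<xi> b) = w $ i" for i
  proof -
    have "p i \<in> UNIV <+> {..<k}" using bij by (auto simp: bij_betw_def)
    moreover have "inv p (p i) = i" using bij by (simp add: bij_betw_def)
    ultimately show ?thesis by (auto simp: proj_left_def split: sum.split)
  qed
  then show "join p (proj_left p w) ?\<xi> = w"
    by (simp add: join_def vec_eq_iff)
qed

section \<open>The weak-PL inequality\<close>

lemma argmin_on_iff: "x \<in> argmin_on S f \<longleftrightarrow> x \<in> S \<and> (\<forall>y\<in>S. f x \<le> f y)"
  by (auto simp: argmin_on_def is_arg_min_def not_less)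

text \<open>Every \<open>w\<close> is a pair \<open>(x, \<xi>)\<close>, so \<open>flft w\<close>
  competes in the minimum defining \<open>f x\<close>. This serves along a lifted curve, whose
  \<open>\<xi>\<close>-component need not stay optimal.\<close>

lemma is_DCL_le_lift:
  assumes "index_split k p" "is_DCL k p f fcvx flft \<Phi>"
  shows "f (proj_left p w) \<le> flft w"
proof -
  obtain \<xi> where \<xi>: "\<xi> \<in> rvec k" "join p (proj_left p w) \<xi> = w"
    using join_proj_left[OF assms(1)] by blast
  obtain \<eta> where "\<eta> \<in> argmin_on (rvec k) (\<lambda>\<xi>. flft (join p (proj_left p w) \<xi>))"
    "f (proj_left p w) = flft (join p (proj_left p w) \<eta>)"
    using assms(2) unfolding is_DCL_def by metis
  then show ?thesis using \<xi> by (auto simp: argmin_on_iff)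
qed

text \<open>The definition of a DCL gives this for one minimiser only, while the supremum in
  \<open>alpha_DCL\<close> ranges over all; minimisers share their value.\<close>

lemma is_DCL_argmin_eq:
  assumes "is_DCL k p f fcvx flft \<Phi>"
    and "\<xi> \<in> argmin_on (rvec k) (\<lambda>\<xi>. flft (join p x \<xi>))"
  shows "flft (join p x \<xi>) = f x"
proof -
  obtain \<eta> where "\<eta> \<in> argmin_on (rvec k) (\<lambda>\<xi>. flft (join p x \<xi>))" "f x = flft (join p x \<eta>)"
    using assms(1) unfolding is_DCL_def by metis
  then show ?thesis using assms(2) by (auto simp: argmin_on_iff intro: antisym)
qed

text \<open>A value of \<open>f\<close> is a value of \<open>flft\<close>, hence either infinite or
  a value of \<open>fcvx\<close>.\<close>

lemma is_DCL_ge_min: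
  assumes "is_DCL k p f fcvx flft \<Phi>" "z \<in> argmin_on UNIV fcvx"
  shows "fcvx z \<le> f y"
proof -
  obtain \<eta> where \<eta>: "f y = flft (join p y \<eta>)"
    using assms(1) unfolding is_DCL_def by metis
  obtain Y where Y: "edom flft \<subseteq> Y" "\<forall>w\<in>Y. flft w = fcvx (\<Phi> w)"
    using assms(1) by (auto simp: is_DCL_def)
  show ?thesis
  proof (cases "join p y \<eta> \<in> edom flft")
    case True
    then show ?thesis using Y \<eta> assms(2) by (auto simp: argmin_on_iff)
  next
    case False
    then show ?thesis using \<eta> by (simp add: edom_def)
  qed
qed

text \<open>If \<open>D\<close> exceeded \<open>b\<close>, then \<open>\<phi> t - t * b\<close>
  would rise above \<open>\<phi> 0\<close> just to the right of 0. The bound is one-sided because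
  convexity controls only \<open>t\<close> between 0 and 1.\<close>

lemma DERIV_le_if_le_line:
  fixes \<phi> :: "real \<Rightarrow> real"
  assumes "(\<phi> has_real_derivative D) (at 0)" "\<forall>\<^sub>F t in at_right 0. \<phi> t \<le> \<phi> 0 + t * b"
  shows "D \<le> b"
proof (rule ccontr)
  assume "\<not> D \<le> b"
  have "((\<lambda>t. \<phi> t - t * b) has_real_derivative D - b) (at 0)"
    using assms(1) by (auto intro!: derivative_eq_intros)
  from DERIV_pos_inc_right[OF this] obtain e where
    e: "0 < e" "\<And>t. 0 < t \<Longrightarrow> t < e \<Longrightarrow> \<phi> 0 < \<phi> t - t * b"
    using \<open>\<not> D \<le> b\<close> by auto
  obtain r where r: "0 < r" "\<And>t. 0 < t \<Longrightarrow> t < r \<Longrightarrow> \<phi> t \<le> \<phi> 0 + t * b"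
    using assms(2) by (auto simp: eventually_at_right_field)
  have "0 < min e r / 2" "min e r / 2 < e" "min e r / 2 < r" using e(1) r(1) by auto
  then show False using e(2) r(2) by fastforce
qed

text \<open>This is the estimate for a single pair \<open>(z, \<xi>)\<close>, free of division.
  Positivity of the singular value provides the right inverse through which the segment from
  \<open>\<Phi> w\<close> to \<open>z\<close> is lifted.\<close>

lemma is_DCL_gradient_bound:
  fixes \<Phi> :: "real^'n \<Rightarrow> real^'z" and x g :: "real^'d"
  assumes split: "index_split k p" and "no_minus_infinity f"
    and dcl: "is_DCL k p f fcvx flft \<Phi>" and grad: "has_egradient f x g"
    and z: "z \<in> argmin_on UNIV fcvx"
    and \<xi>: "\<xi> \<in> argmin_on (rvec k) (\<lambda>\<xi>. flft (join p x \<xi>))"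
    and r: "f x = ereal r" and m: "fcvx z = ereal m"
    and pos: "0 < singular_value CARD('z) (jacobian \<Phi> (at (join p x \<xi>)))"
  shows "singular_value CARD('z) (jacobian \<Phi> (at (join p x \<xi>))) * (r - m)
    \<le> norm g * norm (\<Phi> (join p x \<xi>) - z)"
proof -
  define w where "w = join p x \<xi>"
  define \<sigma> where "\<sigma> = singular_value CARD('z) (jacobian \<Phi> (at w))"
  have "0 < \<sigma>" using pos by (simp add: \<sigma>_def w_def)
  define d where "d = z - \<Phi> w"
  obtain Y where Y: "open Y" "edom flft \<subseteq> Y" "C1_on Y \<Phi>" "\<forall>w\<in>Y. flft w = fcvx (\<Phi> w)"
    and cvx: "econvex fcvx"
    using dcl by (auto simp: is_DCL_def)
  have fw: "flft w = ereal r"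
    using is_DCL_argmin_eq[OF dcl \<xi>] r by (simp add: w_def)
  then have "w \<in> Y" using Y(2) by (auto simp: edom_def)
  then have \<Phi>w: "fcvx (\<Phi> w) = ereal r" using Y(4) fw by auto
  obtain A where A: "linear A" "\<And>d. jacobian \<Phi> (at w) *v A d = d"
      "\<And>d. \<sigma> * norm (A d) \<le> norm d"
    using singular_value_right_inverse[of "jacobian \<Phi> (at w)"] \<open>0 < \<sigma>\<close>
    unfolding \<sigma>_def by blast
  obtain c where c: "c 0 = w" "(c has_vector_derivative A d) (at 0)"
      "\<forall>\<^sub>F t in nhds 0. c t \<in> Y \<and> \<Phi> (c t) = \<Phi> w + t *\<^sub>R d"
    using C1_on_lift_segment[OF Y(1,3) \<open>w \<in> Y\<close> A(1,2), where d = d] by blast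
  define \<phi> where "\<phi> t = real_of_ereal (f (proj_left p (c t)))" for t
  have pw: "proj_left p (c 0) = x" using proj_left_join[OF split] c(1) by (simp add: w_def)
  have \<phi>0: "\<phi> 0 = r" using pw r by (simp add: \<phi>_def)
  have "((\<lambda>t. proj_left p (c t)) has_derivative (\<lambda>t. t *\<^sub>R proj_left p (A d))) (at 0)"
    using bounded_linear.has_derivative[of "proj_left p", OF _ c(2)[unfolded has_vector_derivative_def]]
      linear_proj_left[of p]
    by (simp add: linear_conv_bounded_linear linear_cmul[OF linear_proj_left])
  moreover have "((\<lambda>y. real_of_ereal (f y)) has_derivative (\<lambda>h. g \<bullet> h)) (at (proj_left p (c 0)))"
    using grad pw by (simp add: has_egradient_def gderiv_def inner_commute)
  ultimately have "(\<phi> has_derivative (\<lambda>t. g \<bullet> (t *\<^sub>R proj_left p (A d)))) (at 0)"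
    unfolding \<phi>_def[abs_def] by (rule has_derivative_compose)
  then have der: "(\<phi> has_real_derivative (g \<bullet> proj_left p (A d))) (at 0)"
    by (simp add: has_field_derivative_def mult_commute_abs)
  have "\<forall>\<^sub>F t in at_right 0. c t \<in> Y \<and> \<Phi> (c t) = \<Phi> w + t *\<^sub>R d"
    using c(3) by (simp add: eventually_at_filter eventually_mono)
  moreover have "\<forall>\<^sub>F t :: real in at_right 0. 0 < t \<and> t < 1"
    by (auto simp: eventually_at_right_field intro: exI[of _ 1])
  ultimately have "\<forall>\<^sub>F t in at_right 0. \<phi> t \<le> \<phi> 0 + t * (m - r)"
  proof eventually_elim
    case (elim t)
    have line: "\<Phi> w + t *\<^sub>R d = (1 - t) *\<^sub>R \<Phi> w + t *\<^sub>R z"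
      by (simp add: d_def algebra_simps)
    have "f (proj_left p (c t)) \<le> flft (c t)"
      by (rule is_DCL_le_lift[OF split dcl])
    also have "\<dots> = fcvx ((1 - t) *\<^sub>R \<Phi> w + t *\<^sub>R z)"
      using elim Y(4) line by simp
    also have "\<dots> \<le> ereal (1 - t) * fcvx (\<Phi> w) + ereal t * fcvx z"
      using cvx elim unfolding econvex_def by simp
    also have "\<dots> = ereal (r + t * (m - r))"
      using \<Phi>w m by (simp add: algebra_simps)
    finally have "f (proj_left p (c t)) \<le> ereal (r + t * (m - r))" .
    \<comment> \<open>\<open>real_of_ereal\<close> sends both infinities to 0. The real upper bound
      excludes \<open>\<infinity>\<close>, and this excludes \<open>-\<infinity>\<close>.\<close>
    moreover have "f (proj_left p (c t)) \<noteq> - \<infinity>"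
      using \<open>no_minus_infinity f\<close> by (simp add: no_minus_infinity_def)
    ultimately show ?case
      unfolding \<phi>0 by (cases "f (proj_left p (c t))") (auto simp: \<phi>_def)
  qed
  with der have "g \<bullet> proj_left p (A d) \<le> m - r"
    by (rule DERIV_le_if_le_line)
  \<comment> \<open>Cauchy-Schwarz is applied to \<open>- g\<close>, since the curve is a descent
    direction.\<close>
  moreover have "- (g \<bullet> proj_left p (A d)) \<le> norm g * norm (proj_left p (A d))"
    using norm_cauchy_schwarz[of "- g"] by simp
  moreover have "norm g * norm (proj_left p (A d)) \<le> norm g * norm (A d)"
    by (intro mult_left_mono norm_proj_left_le[OF split]) simp
  ultimately have "r - m \<le> norm g * norm (A d)" by linarith
  then have "\<sigma> * (r - m) \<le> norm g * (\<sigma> * norm (A d))"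
    using \<open>0 < \<sigma>\<close> by (simp add: mult.left_commute)
  also have "\<dots> \<le> norm g * norm d"
    by (intro mult_left_mono A(3)) simp
  finally show ?thesis
    by (simp add: \<sigma>_def w_def d_def norm_minus_commute)
qed

theorem theorem4:
  fixes f :: "real^'d \<Rightarrow> ereal"
    and fcvx :: "real^'z \<Rightarrow> ereal"
    and flft :: "real^'n \<Rightarrow> ereal"
    and \<Phi> :: "real^'n \<Rightarrow> real^'z"
    and k :: nat
    and p :: "'n \<Rightarrow> 'd + nat"
    and x g :: "real^'d"
  assumes "index_split k p"
    and "proper_fun f"
    and "is_DCL k p f fcvx flft \<Phi>"
    and "x \<in> edom f"
    and "has_egradient f x g"
  shows "ereal (norm g) \<ge>
    (if f x = (INF y. f y) then 0
     else alpha_DCL k p fcvx flft \<Phi> x * (f x - (INF y. f y)))"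
proof (cases "f x = (INF y. f y)")
  case True
  then show ?thesis by simp
next
  case False
  have nmi: "no_minus_infinity f" using assms(2) by (simp add: proper_fun_def)
  obtain r where r: "f x = ereal r"
    using nmi assms(4) by (cases "f x") (auto simp: no_minus_infinity_def edom_def)
  have cvx: "proper_fun fcvx" using assms(3) by (simp add: is_DCL_def)
  have min_real: "\<exists>m. fcvx z = ereal m" if z: "z \<in> argmin_on UNIV fcvx" for z
  proof -
    obtain y where "fcvx y \<noteq> \<infinity>" using cvx by (auto simp: proper_fun_def edom_def)
    moreover have "fcvx z \<le> fcvx y" using z by (simp add: argmin_on_iff)
    moreover have "fcvx z \<noteq> - \<infinity>" using cvx by (simp add: proper_fun_def no_minus_infinity_def)
    ultimately show ?thesis by (cases "fcvx z") auto
  qed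
  have min_le: "fcvx z \<le> (INF y. f y)" if "z \<in> argmin_on UNIV fcvx" for z
    using is_DCL_ge_min[OF assms(3) that] by (simp add: INF_greatest)
  have "(INF y. f y) \<le> f x" by (rule INF_lower) simp
  with False have less: "(INF y. f y) < ereal r" using r by simp
  \<comment> \<open>The infimum is finite: it is at least the minimum of \<open>fcvx\<close> and
    strictly below \<open>f x\<close>.\<close>
  obtain i where i: "(INF y. f y) = ereal i"
  proof -
    obtain z where "z \<in> argmin_on UNIV fcvx" using assms(3) by (auto simp: is_DCL_def)
    with min_le min_real obtain m where "ereal m \<le> (INF y. f y)" by metis
    with less that show thesis by (cases "INF y. f y") auto
  qed
  have "i < r" using less i by simp
  have "alpha_DCL k p fcvx flft \<Phi> x \<le> ereal (norm g / (r - i))"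
    unfolding alpha_DCL_def
  proof (rule SUP_least, clarify)
    fix z \<xi>
    assume z: "z \<in> argmin_on UNIV fcvx"
      and \<xi>: "\<xi> \<in> argmin_on (rvec k) (\<lambda>\<xi>. flft (join p x \<xi>))"
    define w where "w = join p x \<xi>"
    define \<sigma> where "\<sigma> = singular_value CARD('z) (jacobian \<Phi> (at w))"
    obtain m where m: "fcvx z = ereal m" using min_real z by blast
    then have "m \<le> i" using min_le[OF z] i by simp
    have flft_w: "flft w = ereal r" using is_DCL_argmin_eq[OF assms(3) \<xi>] r by (simp add: w_def)
    obtain Y where Y: "edom flft \<subseteq> Y" "\<forall>w\<in>Y. flft w = fcvx (\<Phi> w)"
      using assms(3) by (auto simp: is_DCL_def)
    have "w \<in> Y" using Y(1) flft_w by (auto simp: edom_def)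
    then have "fcvx (\<Phi> w) = ereal r" using Y(2) flft_w by simp
    \<comment> \<open>The values of \<open>fcvx\<close> at the two points are \<open>r\<close> and
      \<open>m\<close>, with \<open>m \<le> i < r\<close>, so no denominator in
      \<open>alpha_DCL\<close> vanishes.\<close>
    then have "\<Phi> w \<noteq> z" using m \<open>m \<le> i\<close> \<open>i < r\<close> by auto
    then have n: "0 < norm (\<Phi> w - z)" by simp
    have "\<sigma> * (r - i) \<le> norm g * norm (\<Phi> w - z)"
    proof (cases "0 < \<sigma>")
      case True
      \<comment> \<open>The infimum of \<open>f\<close> may exceed the minimum of
        \<open>fcvx\<close>, which only shrinks the gap to be bounded.\<close>
      then have "\<sigma> * (r - i) \<le> \<sigma> * (r - m)"
        using \<open>m \<le> i\<close> by (intro mult_left_mono) auto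
      also have "\<dots> \<le> norm g * norm (\<Phi> w - z)"
        using is_DCL_gradient_bound[OF assms(1) nmi assms(3,5) z \<xi> r m] True
        by (simp add: \<sigma>_def w_def)
      finally show ?thesis .
    next
      case False
      then have "\<sigma> * (r - i) \<le> 0" using \<open>i < r\<close> by (simp add: mult_le_0_iff)
      also have "0 \<le> norm g * norm (\<Phi> w - z)" by simp
      finally show ?thesis .
    qed
    then have "\<sigma> / norm (\<Phi> w - z) \<le> norm g / (r - i)"
      using n \<open>i < r\<close> by (simp add: field_simps)
    then show "ereal (singular_value CARD('z) (jacobian \<Phi> (at (join p x \<xi>)))) /
        ereal (norm (\<Phi> (join p x \<xi>) - z)) \<le> ereal (norm g / (r - i))"
      using n by (simp add: \<sigma>_def w_def)
  qed
  then have "alpha_DCL k p fcvx flft \<Phi> x * ereal (r - i) \<le> ereal (norm g / (r - i)) * ereal (r - i)"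
    using \<open>i < r\<close> by (intro ereal_mult_right_mono) auto
  also have "\<dots> = ereal (norm g)" using \<open>i < r\<close> by simp
  finally show ?thesis using False r i by simp
qed

end
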